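(* Let $G=(V,V_0,V_1,E,c)$ be a parity game such that for each maximal strongly connected component $C$ of the graph $(V,E)$ there is a color $d$ with $c(v)=d$ for all $v\in C$. Then $\mathtt{psolB}$ completely solves $G$, i.e. $\mathtt{psolB}(G)$ is the empty game.
   Context: A parity game is a tuple $G=(V,V_0,V_1,E,c)$ where $V$ is a finite set of nodes partitioned into $V_0,V_1$, $E\subseteq V\times V$ with every node having a successor, and $c\colon V\to\mathbb{N}$. Let $v.E=\{w\mid(v,w)\in E\}$. For $U\subseteq V$, $G\setminus U$ is the game restricted to $V\setminus U$. $\mathrm{Attr}_p(G,X)$ is the least fixed point of $Z\mapsto X\cup\{v\in V_p\mid v.E\cap Z\ne\emptyset\}\cup\{v\in V_{1-p}\mid v.E\subseteq Z\}$. Let $\mathrm{mpre}_p(A,X,d)=\{v\in V_p\mid c(v)\geq d \wedge v.E\cap(A\cup X)\neq\emptyset\}\cup\{v\in V_{1-p}\mid c(v)\geq d\wedge v.E\subseteq A\cup X\}$; for a nonempty set $X$ of nodes of common color $d$, $\mathrm{MAttr}(X)$ is the least fixed point of $Z\mapsto\mathrm{mpre}_{d\bmod 2}(Z,X,d)$ in the current game. Algorithm $\mathtt{psolB}(G)$: for each color $d$ of $G$ in descending order: let $X$ be the set of nodes of color $d$; repeat: if $X=\emptyset$ go to the next color; if $X\subseteq\mathrm{MAttr}(X)$, return $\mathtt{psolB}(G\setminus\mathrm{Attr}_{d\bmod 2}(G,\mathrm{MAttr}(X)))$; else set $X:=X\cap\mathrm{MAttr}(X)$. If all colors are processed, return $G$.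 *)

theory Defs
  imports Main "Graph_Theory.Digraph_Component" "Graph_Theory.Pair_Digraph"
begin

record 'v game =
  nodes  :: "'v set"
  nodes0 :: "'v set"
  nodes1 :: "'v set"
  edges  :: "('v \<times> 'v) set"
  color  :: "'v \<Rightarrow> nat"

text \<open>The function \<^term>\<open>color\<close> is total in HOL; only its values on the nodes matter.\<close>

locale parity_game =
  fixes G :: "'v game"
  assumes finite_nodes: "finite (nodes G)"
    and nodes_union: "nodes G = nodes0 G \<union> nodes1 G"
    and nodes_disjoint: "nodes0 G \<inter> nodes1 G = {}"
    and edges_subset: "edges G \<subseteq> nodes G \<times> nodes G"
    and has_successor: "v \<in> nodes G \<Longrightarrow> \<exists>w. (v, w) \<in> edges G"

definition game_graph :: "'v game \<Rightarrow> ('v, 'v \<times> 'v) pre_digraph" where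
  "game_graph G = with_proj \<lparr>pverts = nodes G, parcs = edges G\<rparr>"

definition succs :: "'v game \<Rightarrow> 'v \<Rightarrow> 'v set" where
  "succs G v = {w. (v, w) \<in> edges G}"

definition restrict_game :: "'v game \<Rightarrow> 'v set \<Rightarrow> 'v game" where
  "restrict_game G U =
     \<lparr>nodes = nodes G - U, nodes0 = nodes0 G - U, nodes1 = nodes1 G - U,
      edges = edges G \<inter> ((nodes G - U) \<times> (nodes G - U)), color = color G\<rparr>"

text \<open>Players are the numbers 0 and 1, so the opponent of \<open>p\<close> is \<open>1 - p\<close>.\<close>

definition nodes_of :: "'v game \<Rightarrow> nat \<Rightarrow> 'v set" where
  "nodes_of G p = (if p = 0 then nodes0 G else nodes1 G)"

definition Attr :: "nat \<Rightarrow> 'v game \<Rightarrow> 'v set \<Rightarrow> 'v set" where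
  "Attr p G X = lfp (\<lambda>Z. X \<union> {v \<in> nodes_of G p. succs G v \<inter> Z \<noteq> {}}
                           \<union> {v \<in> nodes_of G (1 - p). succs G v \<subseteq> Z})"

definition mpre :: "'v game \<Rightarrow> nat \<Rightarrow> 'v set \<Rightarrow> 'v set \<Rightarrow> nat \<Rightarrow> 'v set" where
  "mpre G p A X d =
     {v \<in> nodes_of G p. color G v \<ge> d \<and> succs G v \<inter> (A \<union> X) \<noteq> {}} \<union>
     {v \<in> nodes_of G (1 - p). color G v \<ge> d \<and> succs G v \<subseteq> A \<union> X}"

text \<open>Only meaningful if \<open>X\<close> is nonempty and all its nodes have the same color,
  which is then \<^term>\<open>the_elem (color G ` X)\<close>.\<close>

definition MAttr :: "'v game \<Rightarrow> 'v set \<Rightarrow> 'v set" where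
  "MAttr G X = (let d = the_elem (color G ` X) in lfp (\<lambda>Z. mpre G (d mod 2) Z X d))"

text \<open>The inner loop of the algorithm: the result is empty iff the loop ends by going to the
  next color.\<close>

partial_function (tailrec) psolB_loop :: "'v game \<Rightarrow> 'v set \<Rightarrow> 'v set" where
  "psolB_loop G X =
     (if X = {} then {}
      else if X \<subseteq> MAttr G X then X
      else psolB_loop G (X \<inter> MAttr G X))"

text \<open>The outer loop over a list of colors, ending with the color and node set with which
  the algorithm calls itself recursively, or with \<^term>\<open>None\<close> if all colors are processed.\<close>

fun psolB_scan :: "'v game \<Rightarrow> nat list \<Rightarrow> (nat \<times> 'v set) option" where
  "psolB_scan G [] = None"
| "psolB_scan G (d # ds) =
     (let X = psolB_loop G {v \<in> nodes G. color G v = d}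
      in if X = {} then psolB_scan G ds else Some (d, X))"

definition colors_desc :: "'v game \<Rightarrow> nat list" where
  "colors_desc G = rev (sorted_list_of_set (color G ` nodes G))"

partial_function (tailrec) psolB :: "'v game \<Rightarrow> 'v game" where
  "psolB G =
     (case psolB_scan G (colors_desc G) of
        None \<Rightarrow> G
      | Some (d, X) \<Rightarrow> psolB (restrict_game G (Attr (d mod 2) G (MAttr G X))))"

end

theory Submission
  imports Defs
begin

text \<open>A bottom strongly connected component \<open>C\<close> of a nonempty game is closed under successors and,
  by assumption, of a single color \<open>d\<close>. So the monotone attractor of any set \<open>X\<close> of nodes of color
  \<open>d\<close> that contains \<open>C\<close> contains \<open>C\<close> as well, and the inner loop for \<open>d\<close> cannot run empty.
  Hence a nonempty game always loses nodes in a recursive call. The remaining game is again a parity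
  game, and deleting nodes only splits strongly connected components, so the assumption survives.\<close>

text \<open>Phrased by mutual reachability instead of component subgraphs: this form passes to
  subsets of the edges by monotonicity of \<open>rtrancl\<close>.\<close>

definition scc_monochromatic :: "'v game \<Rightarrow> bool" where
  "scc_monochromatic G \<longleftrightarrow>
     (\<forall>u v. (u, v) \<in> (edges G)\<^sup>* \<longrightarrow> (v, u) \<in> (edges G)\<^sup>* \<longrightarrow> color G u = color G v)"

lemma scc_monochromaticI:
  assumes "parity_game G"
    and mono: "\<And>C. C \<in> pre_digraph.sccs (game_graph G) \<Longrightarrow> \<exists>d. \<forall>v \<in> verts C. color G v = d"
  shows "scc_monochromatic G"
  unfolding scc_monochromatic_def
proof (intro allI impI)
  fix u v assume uv: "(u, v) \<in> (edges G)\<^sup>*" "(v, u) \<in> (edges G)\<^sup>*"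
  interpret parity_game G by fact
  interpret D: wf_digraph "game_graph G"
    using edges_subset by unfold_locales (auto simp: game_graph_def)
  have simps: "verts (game_graph G) = nodes G" "arcs_ends (game_graph G) = edges G"
    by (simp_all add: game_graph_def)
  show "color G u = color G v"
  \<comment> \<open>A point outside \<open>nodes G\<close> reaches itself reflexively but lies in no
    component; distinct mutually reachable points are endpoints of edges, hence nodes.\<close>
  proof (cases "u = v")
    case False
    then have "u \<in> nodes G" "v \<in> nodes G"
      using uv edges_subset by (auto elim: converse_rtranclE)
    then have "v \<in> D.scc_of u" "u \<in> D.scc_of u"
      using uv by (auto simp: D.scc_of_def D.reachable_conv simps)
    moreover have "D.scc_of u \<in> D.sccs_verts"
      using \<open>u \<in> nodes G\<close> by (simp add: D.scc_of_in_sccs_verts simps)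
    ultimately obtain C where "C \<in> D.sccs" "u \<in> verts C" "v \<in> verts C"
      unfolding D.sccs_verts_conv by auto
    then show ?thesis using mono by metis
  qed simp
qed

lemma scc_monochromatic_restrict:
  assumes "scc_monochromatic G"
  shows "scc_monochromatic (restrict_game G U)"
proof -
  have "(edges (restrict_game G U))\<^sup>* \<subseteq> (edges G)\<^sup>*"
    by (rule rtrancl_mono) (auto simp: restrict_game_def)
  moreover have "color (restrict_game G U) = color G"
    by (simp add: restrict_game_def)
  ultimately show ?thesis
    using assms unfolding scc_monochromatic_def by (metis subsetD)
qed

lemma Attr_unfold:
  "Attr p G X = X \<union> {v \<in> nodes_of G p. succs G v \<inter> Attr p G X \<noteq> {}}
                  \<union> {v \<in> nodes_of G (1 - p). succs G v \<subseteq> Attr p G X}"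
  unfolding Attr_def by (subst lfp_unfold) (auto intro!: monoI)

text \<open>An attractor is a fixed point, so a node outside it has a successor outside it: for
  player \<open>p\<close> no successor lies inside, for the opponent not all do. Hence no dead ends
  arise.\<close>

lemma parity_game_restrict_Attr:
  assumes "parity_game G" and p: "p < 2"
  shows "parity_game (restrict_game G (Attr p G X))"
proof -
  interpret parity_game G by fact
  let ?A = "Attr p G X"
  have succ: "\<exists>w. w \<notin> ?A \<and> (v, w) \<in> edges G" if v: "v \<in> nodes G" "v \<notin> ?A" for v
  proof -
    have "v \<in> nodes_of G p \<or> v \<in> nodes_of G (1 - p)"
      using v(1) p nodes_union by (auto simp: nodes_of_def)
    then have "succs G v \<inter> ?A = {} \<or> \<not> succs G v \<subseteq> ?A"
      using v(2) Attr_unfold[of p G X] by blast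
    then show ?thesis using has_successor[OF v(1)] by (auto simp: succs_def)
  qed
  show ?thesis
  proof
    fix v assume "v \<in> nodes (restrict_game G ?A)"
    then show "\<exists>w. (v, w) \<in> edges (restrict_game G ?A)"
      using succ[of v] edges_subset by (auto simp: restrict_game_def)
  qed (use finite_nodes nodes_union nodes_disjoint in \<open>auto simp: restrict_game_def\<close>)
qed

text \<open>An unsuccessful round removes at least one node from the finite set \<open>X\<close>, so
  induction along proper subsets follows the loop to its end.\<close>

lemma psolB_loop_cases:
  assumes "finite X"
  shows "psolB_loop G X \<subseteq> X \<and> psolB_loop G X \<subseteq> MAttr G (psolB_loop G X)
    \<or> psolB_loop G X = {}"
  using assms
proof (induction X rule: finite_psubset_induct)
  case (psubset X)
  consider "X = {}" | "X \<noteq> {}" "X \<subseteq> MAttr G X" | "X \<noteq> {}" "\<not> X \<subseteq> MAttr G X" by blast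
  then show ?case
  proof cases
    case 3
    then have "X \<inter> MAttr G X \<subset> X" by auto
    then show ?thesis using psubset.IH[of "X \<inter> MAttr G X"] 3
      by (auto simp: psolB_loop.simps[of G X])
  qed (simp_all add: psolB_loop.simps[of G X] psolB_loop.simps[of G "{}"])
qed

text \<open>\<open>C\<close> is a loop invariant. Each node of \<open>C\<close> has color
  \<open>d\<close> and a nonempty set of successors, all inside \<open>X\<close>; one application of
  \<open>mpre\<close> thus captures it, whoever owns it, and intersecting with
  \<open>MAttr G X\<close> loses nothing of \<open>C\<close>.\<close>

lemma psolB_loop_closed_subset:
  assumes "parity_game G" and "finite X" and "C \<subseteq> X" and "C \<noteq> {}" and "C \<subseteq> nodes G"
    and closed: "\<And>v. v \<in> C \<Longrightarrow> succs G v \<subseteq> C" and color: "\<And>v. v \<in> X \<Longrightarrow> color G v = d"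
  shows "C \<subseteq> psolB_loop G X"
  using \<open>finite X\<close> \<open>C \<subseteq> X\<close> color
proof (induction X rule: finite_psubset_induct)
  case (psubset X)
  interpret parity_game G by fact
  \<comment> \<open>\<open>X\<close> contains the nonempty \<open>C\<close>, so
    \<open>the_elem\<close> in \<open>MAttr\<close> really yields \<open>d\<close>.\<close>
  have "color G ` X = {d}" using psubset.prems \<open>C \<noteq> {}\<close> by auto
  then have M: "MAttr G X = lfp (\<lambda>Z. mpre G (d mod 2) Z X d)"
    by (simp add: MAttr_def)
  have "C \<subseteq> MAttr G X"
  proof
    fix v assume v: "v \<in> C"
    then have "v \<in> nodes G" using \<open>C \<subseteq> nodes G\<close> by auto
    then have "v \<in> nodes_of G (d mod 2) \<or> v \<in> nodes_of G (1 - d mod 2)"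
      using nodes_union by (auto simp: nodes_of_def)
    moreover have "succs G v \<noteq> {}"
      using has_successor[OF \<open>v \<in> nodes G\<close>] by (auto simp: succs_def)
    moreover have "succs G v \<subseteq> X" "color G v = d"
      using v closed psubset.prems by auto
    ultimately have "v \<in> mpre G (d mod 2) (MAttr G X) X d"
      unfolding mpre_def by auto
    moreover have "mono (\<lambda>Z. mpre G (d mod 2) Z X d)"
      by (rule monoI) (auto simp: mpre_def)
    ultimately show "v \<in> MAttr G X"
      unfolding M using lfp_unfold by blast
  qed
  then show ?case
    using psubset.IH[of "X \<inter> MAttr G X"] psubset.prems \<open>C \<noteq> {}\<close>
    by (subst psolB_loop.simps) auto
qed

lemma bottom_scc_exists:
  assumes "parity_game G" and "scc_monochromatic G" and "nodes G \<noteq> {}"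
  obtains C d where "C \<noteq> {}" "C \<subseteq> nodes G" "\<And>v. v \<in> C \<Longrightarrow> succs G v \<subseteq> C"
    "\<And>v. v \<in> C \<Longrightarrow> color G v = d"
proof -
  interpret parity_game G by fact
  define R where "R v = (edges G)\<^sup>* `` {v}" for v
  have R_nodes: "R v \<subseteq> nodes G" if "v \<in> nodes G" for v
    using that edges_subset by (auto simp: R_def elim: rtranclE)
  \<comment> \<open>Choose a smallest reachability set. Every \<open>w\<close> in \<open>R v\<close>
    has \<open>R w\<close> inside \<open>R v\<close>, so minimality forces equality and
    \<open>w\<close> reaches \<open>v\<close> back: \<open>R v\<close> is a bottom
    component.\<close>
  obtain v where v: "v \<in> nodes G" and min: "\<And>w. w \<in> nodes G \<Longrightarrow> card (R v) \<le> card (R w)"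
    using \<open>nodes G \<noteq> {}\<close> exists_least_iff[of "\<lambda>n. \<exists>v\<in>nodes G. card (R v) = n"]
    by (metis ex_in_conv not_le_imp_less)
  have "R w = R v" if "w \<in> R v" for w
  proof (rule card_seteq)
    show "finite (R v)" using R_nodes[OF v] finite_nodes by (rule finite_subset)
    show "R w \<subseteq> R v" using that by (auto simp: R_def)
    show "card (R v) \<le> card (R w)" using that R_nodes[OF v] min by auto
  qed
  then have "color G w = color G v" if "w \<in> R v" for w
    using that \<open>scc_monochromatic G\<close> unfolding scc_monochromatic_def
    by (metis Image_singleton_iff R_def rtrancl.rtrancl_refl)
  moreover have "v \<in> R v" by (simp add: R_def)
  moreover have "succs G w \<subseteq> R v" if "w \<in> R v" for w
    using that by (auto simp: R_def succs_def)
  ultimately show thesis using that[of "R v"] R_nodes[OF v] by blast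
qed

lemma psolB_scan_SomeD:
  assumes "psolB_scan G ds = Some (d, X)"
  shows "X \<noteq> {} \<and> X = psolB_loop G {v \<in> nodes G. color G v = d}"
  using assms by (induction ds) (auto simp: Let_def split: if_splits)

lemma psolB_scan_NoneD:
  assumes "psolB_scan G ds = None" "d \<in> set ds"
  shows "psolB_loop G {v \<in> nodes G. color G v = d} = {}"
  using assms by (induction ds) (auto simp: Let_def split: if_splits)

lemma psolB_scan_not_None:
  assumes "parity_game G" and "scc_monochromatic G" and "nodes G \<noteq> {}"
  shows "psolB_scan G (colors_desc G) \<noteq> None"
proof
  assume none: "psolB_scan G (colors_desc G) = None"
  interpret parity_game G by fact
  obtain C d where C: "C \<noteq> {}" "C \<subseteq> nodes G" "\<And>v. v \<in> C \<Longrightarrow> succs G v \<subseteq> C"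
    "\<And>v. v \<in> C \<Longrightarrow> color G v = d"
    using bottom_scc_exists[OF assms] by metis
  then have "d \<in> color G ` nodes G" by blast
  then have "d \<in> set (colors_desc G)"
    using finite_nodes by (simp add: colors_desc_def)
  then have "psolB_loop G {v \<in> nodes G. color G v = d} = {}"
    using none by (rule psolB_scan_NoneD[rotated])
  moreover have "C \<subseteq> psolB_loop G {v \<in> nodes G. color G v = d}"
    using C finite_nodes by (intro psolB_loop_closed_subset[OF \<open>parity_game G\<close>]) auto
  ultimately show False using C(1) by auto
qed

lemma psolB_empty:
  assumes "parity_game G" and "scc_monochromatic G"
  shows "nodes (psolB G) = {}"
  using assms
proof (induction "card (nodes G)" arbitrary: G rule: less_induct)
  case less
  interpret parity_game G by fact
  show ?case
  proof (cases "nodes G = {}")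
    case True
    \<comment> \<open>Without nodes there are no colors to scan, so the game itself is
      returned.\<close>
    then show ?thesis by (simp add: psolB.simps[of G] colors_desc_def)
  next
    case False
    then obtain d X where scan: "psolB_scan G (colors_desc G) = Some (d, X)"
      using psolB_scan_not_None[OF less.prems] by auto
    let ?A = "Attr (d mod 2) G (MAttr G X)"
    let ?H = "restrict_game G ?A"
    have X: "X \<noteq> {}" "X = psolB_loop G {v \<in> nodes G. color G v = d}"
      using psolB_scan_SomeD[OF scan] by auto
    \<comment> \<open>A nonempty loop result lies in its own monotone attractor, so the nodes
      deleted next include all of \<open>X\<close>.\<close>
    then have "X \<subseteq> nodes G" "X \<subseteq> MAttr G X"
      using psolB_loop_cases[of "{v \<in> nodes G. color G v = d}" G] finite_nodes by auto
    moreover have "MAttr G X \<subseteq> ?A" using Attr_unfold[of "d mod 2" G "MAttr G X"] by blast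
    ultimately have "nodes ?H \<subset> nodes G"
      using X(1) by (auto simp: restrict_game_def)
    then have "nodes (psolB ?H) = {}"
      using less finite_nodes
      by (simp add: psubset_card_mono parity_game_restrict_Attr scc_monochromatic_restrict)
    then show ?thesis by (simp add: psolB.simps[of G] scan)
  qed
qed

theorem theorem8:
  fixes G :: "'v game"
  assumes "parity_game G"
    and "\<And>C. C \<in> pre_digraph.sccs (game_graph G) \<Longrightarrow> \<exists>d. \<forall>v \<in> verts C. color G v = d"
  shows "nodes (psolB G) = {}"
  using psolB_empty scc_monochromaticI assms by blast

end
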